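(* Let $q$ be a prime power, let $n$ and $m\ge 3$ be positive integers, and let $I,J$ be nonnegative integers with $I<J<n$; put $K:=J-I$ and, for positive integers $h,\ell$, $C_{h,\ell}:=\frac{q^{h\ell}-1}{q^h-1}$. Let $\alpha_1,\dots,\alpha_m\in\mathbb{F}_{q^n}^*$, $\mathbf{A}=(\alpha_1,\dots,\alpha_m)$, and $$U^{I,J}_{\mathbf{A}}:=\{(x_1,\dots,x_m,f_1(\underline{x}),\dots,f_m(\underline{x})) : x_1,\dots,x_m\in\mathbb{F}_{q^n}\}\subseteq \mathbb{F}_{q^n}^{2m},$$ where $f_i(\underline{x})=x_i^{q^I}+\alpha_{i+1}x_{i+1}^{q^J}$ for $i=1,\dots,m-1$ and $f_m(\underline{x})=x_m^{q^I}+\alpha_1x_1^{q^J}$. Assume $\gcd(I,J)=1$ and that $$K^{I,J}_{\mathbf{A}}:=\frac{\alpha_3\,\alpha_4^{q^K}\,\alpha_5^{q^{2K}}\cdots\alpha_m^{q^{(m-3)K}}\,\alpha_1^{q^{(m-2)K}}}{\alpha_2^{C_{K,m-1}}}$$ is not a $C_{K,m}$-power in $\mathbb{F}_{q^n}$. Then $U^{I,J}_{\mathbf{A}}$ is scattered.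
   Context: An element $a$ of a field $F$ is a $d$-power in $F$ if $a=y^d$ for some $y\in F$. An $\mathbb{F}_q$-subspace $U$ of $\mathbb{F}_{q^n}^k$ is scattered if $\dim_{\mathbb{F}_q}(U\cap\langle v\rangle_{\mathbb{F}_{q^n}})\le 1$ for every $v\in\mathbb{F}_{q^n}^k$. Note $U^{I,J}_{\mathbf{A}}$ is an $\mathbb{F}_q$-subspace of $\mathbb{F}_{q^n}^{2m}$ of $\mathbb{F}_q$-dimension $mn$. *)

theory Defs
  imports
    "Jordan_Normal_Form.VS_Connect"
    "HOL-Library.Cardinality"
    "HOL-Number_Theory.Prime_Powers"
    "HOL-Computational_Algebra.Nth_Powers"
begin

text \<open>
  The field with \<open>q^n\<close> elements is a type \<open>'a\<close> of class \<open>field\<close> and \<open>finite\<close> with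
  \<open>CARD('a) = q ^ n\<close>.  Its unique subfield with \<open>q\<close> elements is the set of roots of
  \<open>X^q - X\<close>.  Keeping the module record \<open>module_vec TYPE('a) k\<close> and replacing only the
  base ring restricts the scalars of \<open>'a^k\<close> to that subfield.
\<close>

definition Fq :: "nat \<Rightarrow> 'a::field ring" where
  "Fq q = class_ring\<lparr>carrier := {x. x ^ q = x}\<rparr>"

definition scattered :: "nat \<Rightarrow> nat \<Rightarrow> 'a::field vec set \<Rightarrow> bool" where
  "scattered q k U \<longleftrightarrow>
     VectorSpace.subspace (Fq q) U (module_vec TYPE('a) k) \<and>
     (\<forall>v \<in> carrier_vec k.
        vectorspace.dim (Fq q)
          ((module_vec TYPE('a) k)
             \<lparr>carrier := U \<inter> LinearCombinations.module.span class_ring (module_vec TYPE('a) k) {v}\<rparr>)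
        \<le> 1)"

text \<open>The division is exact for \<open>h > 0\<close> and \<open>q > 1\<close>.\<close>

definition C_const :: "nat \<Rightarrow> nat \<Rightarrow> nat \<Rightarrow> nat" where
  "C_const q h l = (q ^ (h * l) - 1) div (q ^ h - 1)"

text \<open>
  Families \<open>x\<close> and \<open>\<alpha>\<close> are indexed by \<open>1, \<dots>, m\<close>; values at other indices are never used.
  Entries of vectors are indexed from \<open>0\<close>.
\<close>

definition f_coord :: "nat \<Rightarrow> nat \<Rightarrow> nat \<Rightarrow> nat \<Rightarrow> (nat \<Rightarrow> 'a::field) \<Rightarrow> (nat \<Rightarrow> 'a) \<Rightarrow> nat \<Rightarrow> 'a" where
  "f_coord q m I J \<alpha> x i =
     (if i < m then x i ^ (q ^ I) + \<alpha> (i + 1) * x (i + 1) ^ (q ^ J)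
      else x m ^ (q ^ I) + \<alpha> 1 * x 1 ^ (q ^ J))"

definition U_set :: "nat \<Rightarrow> nat \<Rightarrow> nat \<Rightarrow> nat \<Rightarrow> (nat \<Rightarrow> 'a::field) \<Rightarrow> 'a vec set" where
  "U_set q m I J \<alpha> =
     {vec m (\<lambda>i. x (i + 1)) @\<^sub>v vec m (\<lambda>i. f_coord q m I J \<alpha> x (i + 1)) | x. True}"

definition K_const :: "nat \<Rightarrow> nat \<Rightarrow> nat \<Rightarrow> nat \<Rightarrow> (nat \<Rightarrow> 'a::field) \<Rightarrow> 'a" where
  "K_const q m I J \<alpha> =
     (let K = J - I in
       (\<Prod>i = 3..m. \<alpha> i ^ (q ^ ((i - 3) * K))) * \<alpha> 1 ^ (q ^ ((m - 2) * K))
         / \<alpha> 2 ^ C_const q K (m - 1))"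

end

theory Submission
  imports Defs "HOL-Number_Theory.Residues"
begin

text \<open>
  Suppose \<open>u\<close> and \<open>c u\<close> both lie in \<open>U\<close>, where \<open>u \<noteq> 0\<close> is given by \<open>x\<close>.  Comparing coordinates
  gives \<open>(c^(q^I) - c) x\<^sub>i^(q^I) = (c - c^(q^J)) \<alpha>\<^sub>i\<^sub>+\<^sub>1 x\<^sub>i\<^sub>+\<^sub>1^(q^J)\<close> with cyclic indices.  If both
  coefficients vanish, then \<open>c\<close> lies in \<open>F\<^sub>q\<close> because \<open>gcd I J = 1\<close>; if exactly one vanishes, then
  \<open>x = 0\<close>.  Otherwise all \<open>x\<^sub>i\<close> are nonzero, and with \<open>y\<^sub>i = x\<^sub>i^(q^I)\<close>, \<open>Q = q^(J - I)\<close> and \<open>d\<close> the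
  quotient of the coefficients, \<open>y\<^sub>i = d \<alpha>\<^sub>i\<^sub>+\<^sub>1 y\<^sub>i\<^sub>+\<^sub>1^Q\<close>.  Going once around the cycle from \<open>y\<^sub>2\<close>
  back to \<open>y\<^sub>2\<close> exhibits \<open>K_const\<close> as the \<open>C\<^sub>K\<^sub>,\<^sub>m\<close>-th power of \<open>1 / (d y\<^sub>2^(Q - 1) \<alpha>\<^sub>2)\<close>.
\<close>

section \<open>Frobenius powers on the finite field\<close>

lemma frobenius_add:
  fixes x y :: "'a::{field,finite}"
  assumes "primepow q" and "CARD('a) = q ^ n"
  shows "(x + y) ^ (q ^ k) = x ^ (q ^ k) + y ^ (q ^ k)"
proof -
  define p where "p = CHAR('a)"
  have p: "prime p"
    unfolding p_def by (rule prime_CHAR_semidom) (simp add: finite_imp_CHAR_pos)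
  obtain r e where r: "prime r" and e: "q = r ^ e"
    using assms(1) by (auto simp: primepow_def)
  \<comment> \<open>The prime \<open>r\<close> underlying \<open>q\<close> is the characteristic, so
    raising to \<open>q ^ k\<close> iterates the \<open>p\<close>-th power map.\<close>
  have "p dvd q ^ n"
    using CHAR_dvd_CARD[where ?'a = 'a] assms(2) by (simp add: p_def)
  then have "p dvd r"
    using p e by (metis prime_dvd_power)
  then have "p = r"
    using p r by (simp add: primes_dvd_imp_eq)
  have base: "(a + b) ^ p = a ^ p + b ^ p" for a b :: 'a
  proof -
    have zero: "of_nat (p choose i) = (0::'a)" if "i \<in> {1..<p}" for i
      using dvd_choose_prime[of i p] that p by (simp add: of_nat_eq_0_iff_char_dvd p_def)
    have split: "{..p} = insert 0 (insert p {1..<p})"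
      by auto
    have "(a + b) ^ p = (\<Sum>i\<le>p. of_nat (p choose i) * a ^ i * b ^ (p - i))"
      by (rule binomial_ring)
    also have "\<dots> = b ^ p + a ^ p"
      using prime_gt_0_nat[OF p] zero by (simp add: split)
    finally show ?thesis
      by simp
  qed
  have "(a + b) ^ (p ^ j) = a ^ (p ^ j) + b ^ (p ^ j)" for a b :: 'a and j
  proof (induction j)
    case (Suc j)
    have "(a + b) ^ (p ^ Suc j) = ((a + b) ^ (p ^ j)) ^ p"
      by (simp only: power_Suc2 power_mult)
    also have "\<dots> = a ^ (p ^ Suc j) + b ^ (p ^ Suc j)"
      by (simp only: Suc base power_Suc2 power_mult)
    finally show ?case .
  qed simp
  from this[of x y "e * k"] show ?thesis
    by (simp add: e \<open>p = r\<close> power_mult)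
qed

lemma power_power_fixed:
  fixes x :: "'a::monoid_mult"
  assumes "x ^ a = x"
  shows "x ^ (a ^ k) = x"
  using assms by (induction k) (simp_all add: power_mult)

text \<open>Euclid's algorithm on the exponents: an element fixed by the power \<open>q ^ j\<close>
  is fixed by all iterates of that map, so \<open>i\<close> may be replaced by
  \<open>i mod j\<close>.\<close>

lemma frobenius_fixed_gcd:
  fixes x :: "'a::monoid_mult"
  assumes "x ^ (q ^ i) = x" and "x ^ (q ^ j) = x"
  shows "x ^ (q ^ gcd i j) = x"
  using assms
proof (induction i j rule: gcd_nat_induct)
  case (step i j)
  have "x ^ (q ^ (j * (i div j))) = x"
    using step.prems(2) by (simp add: power_mult power_power_fixed)
  then have "x ^ (q ^ (j * (i div j) + i mod j)) = x ^ (q ^ (i mod j))"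
    by (simp only: power_add power_mult)
  then have "x ^ (q ^ (i mod j)) = x"
    using step.prems(1) by simp
  then show ?case
    using step by (simp add: gcd_red_nat[of i j])
qed simp

section \<open>Geometric sums and the cyclic system of equations\<close>

lemma sum_powers_mult_nat:
  fixes Q :: nat
  assumes "Q > 0"
  shows "(Q - 1) * (\<Sum>j<l. Q ^ j) + 1 = Q ^ l"
proof (induction l)
  case (Suc l)
  have "(Q - 1) * (\<Sum>j<Suc l. Q ^ j) + 1 = Q ^ l + (Q - 1) * Q ^ l"
    using Suc by (simp add: distrib_left)
  also have "\<dots> = Q ^ Suc l"
    using assms by (simp add: diff_mult_distrib)
  finally show ?case .
qed simp

lemma C_const_eq_sum:
  assumes "q > 1" and "h > 0"
  shows "C_const q h l = (\<Sum>j<l. (q ^ h) ^ j)"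
proof -
  have "q ^ h > 1"
    using assms by (intro one_less_power)
  moreover have "q ^ (h * l) - 1 = (q ^ h - 1) * (\<Sum>j<l. (q ^ h) ^ j)"
    using sum_powers_mult_nat[of "q ^ h" l] assms(1) by (simp add: power_mult)
  ultimately show ?thesis
    unfolding C_const_def by simp
qed

text \<open>Each substitution for the last \<open>y\<close> happens inside one more
  \<open>Q\<close>-th power, so the exponents of \<open>c\<close> add up to a geometric sum.
  Starting at index 2 makes the product match the numerator of \<open>K_const\<close>.\<close>

lemma cyclic_system_unroll:
  fixes y \<alpha> :: "nat \<Rightarrow> 'a::field"
  assumes "\<And>i. i \<in> {1..<m} \<Longrightarrow> y i = c * \<alpha> (i + 1) * y (i + 1) ^ Q"
    and "k + 2 \<le> m"
  shows "y 2 = c ^ (\<Sum>j<k. Q ^ j) * (\<Prod>i = 3..k + 2. \<alpha> i ^ (Q ^ (i - 3))) * y (k + 2) ^ (Q ^ k)"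
  using assms(2)
proof (induction k)
  case (Suc k)
  have y: "y (k + 2) = c * \<alpha> (k + 3) * y (k + 3) ^ Q"
    using assms(1)[of "k + 2"] Suc.prems by (simp add: numeral_3_eq_3)
  define P where "P = (\<Prod>i = 3..k + 2. \<alpha> i ^ (Q ^ (i - 3)))"
  have "{3..Suc k + 2} = insert (k + 3) {3..k + 2}"
    by auto
  then have P: "(\<Prod>i = 3..Suc k + 2. \<alpha> i ^ (Q ^ (i - 3))) = \<alpha> (k + 3) ^ (Q ^ k) * P"
    by (simp add: P_def)
  have "y 2 = c ^ (\<Sum>j<k. Q ^ j) * P * (c * \<alpha> (k + 3) * y (k + 3) ^ Q) ^ (Q ^ k)"
    using Suc y by (simp add: P_def)
  also have "\<dots> = c ^ (\<Sum>j<Suc k. Q ^ j) * (\<alpha> (k + 3) ^ (Q ^ k) * P) * y (k + 3) ^ (Q ^ Suc k)"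
    by (simp add: power_add power_mult_distrib power_mult[symmetric] ac_simps)
  finally show ?case
    unfolding P by (simp add: numeral_3_eq_3)
qed (simp add: numeral_2_eq_2)

lemma cyclic_system_solution_imp_nth_power:
  fixes y \<alpha> :: "nat \<Rightarrow> 'a::field"
  assumes "q > 1" and "I < J" and "m \<ge> 3"
    and rec: "\<And>i. i \<in> {1..<m} \<Longrightarrow> y i = c * \<alpha> (i + 1) * y (i + 1) ^ (q ^ (J - I))"
    and wrap: "y m = c * \<alpha> 1 * y 1 ^ (q ^ (J - I))"
    and nz: "c \<noteq> 0" "\<alpha> 2 \<noteq> 0" "y 2 \<noteq> 0"
  shows "is_nth_power (C_const q (J - I) m) (K_const q m I J \<alpha>)"
proof -
  define Q where "Q = q ^ (J - I)"
  define S where "S l = (\<Sum>j<l. Q ^ j)" for l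
  define P where "P = (\<Prod>i = 3..m. \<alpha> i ^ (Q ^ (i - 3)))"
  have C: "C_const q (J - I) l = S l" for l
    using assms(1,2) by (simp add: C_const_eq_sum S_def Q_def)
  \<comment> \<open>This removes the truncated subtractions \<open>m - 1\<close> and
    \<open>m - 2\<close> and lets \<open>S m\<close> unfold to
    \<open>S k + Q ^ k + Q ^ Suc k\<close>, the exponent of \<open>c\<close> after a full
    turn.\<close>
  obtain k where m: "m = Suc (Suc k)"
    using assms(3) by (intro that[of "m - 2"]) simp
  have "Q > 0"
    using assms(1) by (simp add: Q_def)
  \<comment> \<open>Splits \<open>y 2 ^ (Q ^ m)\<close> into one factor \<open>y 2\<close>, which
    cancels, and an \<open>S m\<close>-th power.\<close>
  then have Qm: "Q ^ m = 1 + S m * (Q - 1)"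
    using sum_powers_mult_nat[of Q m] by (simp add: S_def mult.commute)
  have y1: "y 1 = c * \<alpha> 2 * y 2 ^ Q"
    using rec[of 1] assms(3) by (simp add: Q_def numeral_2_eq_2)
  have ym: "y m = c * \<alpha> 1 * (c * \<alpha> 2 * y 2 ^ Q) ^ Q"
    using wrap y1 by (simp add: Q_def)
  have "y 2 = c ^ S k * P * y m ^ (Q ^ k)"
    using cyclic_system_unroll[of m y c \<alpha> Q k] rec by (simp add: S_def P_def Q_def m)
  also have "\<dots> = c ^ S m * (P * \<alpha> 1 ^ (Q ^ k)) * \<alpha> 2 ^ (Q ^ Suc k) * y 2 ^ (Q ^ m)"
    unfolding ym by (simp add: S_def m power_mult_distrib power_add power_mult[symmetric] ac_simps)
  also have "\<dots> = y 2 * ((c * y 2 ^ (Q - 1)) ^ S m * (P * \<alpha> 1 ^ (Q ^ k)) * \<alpha> 2 ^ (Q ^ Suc k))"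
    by (simp only: Qm power_add power_mult power_mult_distrib power_one_right)
       (simp add: power_mult[symmetric] ac_simps)
  finally have eq: "(c * y 2 ^ (Q - 1)) ^ S m * (P * \<alpha> 1 ^ (Q ^ k)) * \<alpha> 2 ^ (Q ^ Suc k) = 1"
    using nz(3) by simp
  have "P * \<alpha> 1 ^ (Q ^ k) / \<alpha> 2 ^ S (Suc k) = inverse (c * y 2 ^ (Q - 1) * \<alpha> 2) ^ S m"
  proof -
    \<comment> \<open>The denominator of \<open>K_const\<close> is exactly what completes
      \<open>\<alpha> 2 ^ (Q ^ Suc k)\<close> to an \<open>S m\<close>-th power.\<close>
    have "S m = S (Suc k) + Q ^ Suc k"
      by (simp add: S_def m)
    then have "(c * y 2 ^ (Q - 1) * \<alpha> 2) ^ S m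
        = (c * y 2 ^ (Q - 1)) ^ S m * \<alpha> 2 ^ (Q ^ Suc k) * \<alpha> 2 ^ S (Suc k)"
      by (simp add: power_mult_distrib power_add)
    then have "(P * \<alpha> 1 ^ (Q ^ k)) * (c * y 2 ^ (Q - 1) * \<alpha> 2) ^ S m = \<alpha> 2 ^ S (Suc k)"
      using eq by (simp add: ac_simps)
    then show ?thesis
      using nz by (simp add: power_inverse field_simps)
  qed
  moreover have "K_const q m I J \<alpha> = P * \<alpha> 1 ^ (Q ^ k) / \<alpha> 2 ^ S (Suc k)"
    unfolding K_const_def Let_def C P_def Q_def
    by (simp add: m power_mult[symmetric] mult.commute)
  ultimately show ?thesis
    unfolding is_nth_power_def C by auto
qed

text \<open>The hypothesis \<open>hom\<close> says that \<open>c\<close> times the vector of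
  \<open>x\<close> is again in U: its first half forces the parameters \<open>c * x\<close>.\<close>

lemma f_coord_proportional_imp_Fq:
  fixes \<alpha> x :: "nat \<Rightarrow> 'a::field"
  assumes "q > 1" and "I < J" and "m \<ge> 3"
    and \<alpha>: "\<forall>i \<in> {1..m}. \<alpha> i \<noteq> 0"
    and "gcd I J = 1"
    and not_power: "\<not> is_nth_power (C_const q (J - I) m) (K_const q m I J \<alpha>)"
    and hom: "\<And>i. i \<in> {1..m} \<Longrightarrow> f_coord q m I J \<alpha> (\<lambda>j. c * x j) i = c * f_coord q m I J \<alpha> x i"
    and "\<exists>i \<in> {1..m}. x i \<noteq> 0"
  shows "c ^ q = c"
proof (rule ccontr)
  assume "c ^ q \<noteq> c"
  define a where "a = c ^ (q ^ I) - c"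
  define b where "b = c - c ^ (q ^ J)"
  define y where "y i = x i ^ (q ^ I)" for i
  \<comment> \<open>The cyclic successor on \<open>{1..m}\<close> merges the two cases of
    \<open>f_coord\<close>.\<close>
  define s where "s i = (if i < m then i + 1 else 1)" for i
  have J: "q ^ J = q ^ I * q ^ (J - I)"
    using assms(2) by (simp add: power_add[symmetric])
  have sys: "a * y i = b * (\<alpha> (s i) * y (s i) ^ (q ^ (J - I)))" if "i \<in> {1..m}" for i
    using hom[OF that] that
    by (cases "i = m")
       (simp_all add: f_coord_def a_def b_def y_def s_def power_mult_distrib J power_mult algebra_simps)
  have s_in: "s i \<in> {1..m}" if "i \<in> {1..m}" for i
    using that by (auto simp: s_def)
  have s_onto: "\<exists>j \<in> {1..m}. s j = i" if "i \<in> {1..m}" for i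
  proof (cases "i = 1")
    case True
    then show ?thesis
      using assms(3) by (intro bexI[of _ m]) (auto simp: s_def)
  next
    case False
    then show ?thesis
      using that by (intro bexI[of _ "i - 1"]) (auto simp: s_def)
  qed
  have y0: "y i = 0 \<longleftrightarrow> x i = 0" for i
    using assms(1) by (simp add: y_def)
  have zero_Q: "(0::'a) ^ (q ^ (J - I)) = 0"
    using assms(1) by (simp add: zero_power)
  have "\<not> (a = 0 \<and> b = 0)"
    using frobenius_fixed_gcd[of c q I J] assms(5) \<open>c ^ q \<noteq> c\<close> by (auto simp: a_def b_def)
  \<comment> \<open>Otherwise \<open>y\<close> vanishes at every successor, hence everywhere, as
    \<open>s\<close> is onto.\<close>
  moreover have "b = 0" if "a = 0"
  proof (rule ccontr)
    assume "b \<noteq> 0"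
    then have "y (s j) = 0" if "j \<in> {1..m}" for j
      using sys[OF that] \<open>a = 0\<close> \<alpha> s_in[OF that] by auto
    then show False
      using s_onto y0 assms(8) by metis
  qed
  moreover have "a = 0" if "b = 0"
    using sys that y0 assms(8) by (metis mult_eq_0_iff)
  ultimately have nz: "a \<noteq> 0" "b \<noteq> 0"
    by auto
  have step: "y i = b / a * \<alpha> (s i) * y (s i) ^ (q ^ (J - I))" if "i \<in> {1..m}" for i
    using sys[OF that] nz by (simp add: field_simps)
  \<comment> \<open>By \<open>step\<close>, a zero at \<open>s i\<close> gives a zero at
    \<open>i\<close>; going backwards from 2 through 1 and \<open>m\<close> it would reach every
    index.\<close>
  have "y 2 \<noteq> 0"
  proof
    assume "y 2 = 0"
    then have y1: "y 1 = 0"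
      using step[of 1] assms(3) zero_Q by (simp add: s_def numeral_2_eq_2)
    have down: "y (m - k) = 0" if "k < m" for k
      using that
    proof (induction k)
      case 0
      then show ?case
        using step[of m] y1 zero_Q by (simp add: s_def)
    next
      case (Suc k)
      then have "s (m - Suc k) = m - k"
        by (simp add: s_def)
      then show ?case
        using step[of "m - Suc k"] Suc zero_Q by simp
    qed
    have "y i = 0" if "i \<in> {1..m}" for i
      using down[of "m - i"] that by simp
    then show False
      using y0 assms(8) by auto
  qed
  have "is_nth_power (C_const q (J - I) m) (K_const q m I J \<alpha>)"
  proof (rule cyclic_system_solution_imp_nth_power[where y = y and c = "b / a"])
    show "y i = b / a * \<alpha> (i + 1) * y (i + 1) ^ (q ^ (J - I))" if "i \<in> {1..<m}" for i
      using step[of i] that by (simp add: s_def)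
    show "y m = b / a * \<alpha> 1 * y 1 ^ (q ^ (J - I))"
      using step[of m] assms(3) by (simp add: s_def)
  qed (use assms nz \<open>y 2 \<noteq> 0\<close> in auto)
  with not_power show False ..
qed

section \<open>Linear algebra over the subfield with q elements\<close>

lemma Fq_simps:
  "carrier (Fq q :: 'a::field ring) = {x. x ^ q = x}"
  "monoid.mult (Fq q :: 'a ring) = (*)"
  "ring.add (Fq q :: 'a ring) = (+)"
  "monoid.one (Fq q :: 'a ring) = 1"
  "ring.zero (Fq q :: 'a ring) = 0"
  by (simp_all add: Fq_def)

lemma field_Fq:
  assumes "primepow q" and "CARD('a::{field,finite}) = q ^ n"
  shows "field (Fq q :: 'a ring)"
proof -
  have q: "q > 0"
    using primepow_gt_Suc_0[OF assms(1)] by simp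
  have add: "(x + y) ^ q = x ^ q + y ^ q" for x y :: 'a
    using frobenius_add[OF assms, of x y 1] by simp
  \<comment> \<open>Additivity at \<open>x + (- x) = 0\<close> avoids a case split on the parity of
    \<open>q\<close>.\<close>
  have neg: "(- x) ^ q = - (x ^ q)" for x :: 'a
    using add[of x "- x"] q by (simp add: eq_neg_iff_add_eq_0 add.commute zero_power)
  have "cring (Fq q :: 'a ring)"
  proof (rule cringI)
    show "abelian_group (Fq q :: 'a ring)"
      by (rule abelian_groupI)
         (use q in \<open>auto simp: Fq_simps add neg intro: exI[of _ "- _"]\<close>)
    show "comm_monoid (Fq q :: 'a ring)"
      by (rule comm_monoidI) (auto simp: Fq_simps power_mult_distrib)
  qed (simp add: Fq_simps distrib_right)
  then show ?thesis
  proof (rule cring.cring_fieldI2)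
    show "\<exists>b \<in> carrier (Fq q). a \<otimes>\<^bsub>Fq q\<^esub> b = \<one>\<^bsub>Fq q\<^esub>"
      if "a \<in> carrier (Fq q)" "a \<noteq> \<zero>\<^bsub>Fq q\<^esub>" for a :: 'a
      using that by (intro bexI[of _ "inverse a"]) (auto simp: Fq_simps power_inverse)
  qed (simp add: Fq_simps)
qed

lemma vectorspace_Fq_vec:
  assumes "primepow q" and "CARD('a::{field,finite}) = q ^ n"
  shows "vectorspace (Fq q) (module_vec TYPE('a) k)"
proof -
  interpret V: vec_space "TYPE('a)" k .
  interpret F: field "Fq q :: 'a ring"
    by (rule field_Fq[OF assms])
  have "Module.module (Fq q) (module_vec TYPE('a) k)"
  proof (rule Module.module.intro)
    show "cring (Fq q :: 'a ring)" ..
    show "abelian_group (module_vec TYPE('a) k)" ..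
    show "module_axioms (Fq q) (module_vec TYPE('a) k)"
      by unfold_locales
         (auto simp: Fq_simps module_vec_simps add_smult_distrib_vec smult_add_distrib_vec)
  qed
  then show ?thesis
    by (rule vectorspace.intro) (rule F.field_axioms)
qed

text \<open>U is the range of the map \<open>emb\<close>, which is additive by Frobenius and
  commutes with scalars \<open>c\<close> satisfying \<open>c ^ q = c\<close>, as these are fixed by
  all powers \<open>q ^ k\<close>.\<close>

lemma subspace_U_set:
  fixes \<alpha> :: "nat \<Rightarrow> 'a::{field,finite}"
  assumes "primepow q" and "CARD('a) = q ^ n"
  shows "VectorSpace.subspace (Fq q) (U_set q m I J \<alpha>) (module_vec TYPE('a) (2 * m))"
proof (rule subspace.intro)
  show vs: "vectorspace (Fq q) (module_vec TYPE('a) (2 * m))"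
    by (rule vectorspace_Fq_vec[OF assms])
  have q: "q > 0"
    using primepow_gt_Suc_0[OF assms(1)] by simp
  define emb where "emb x = vec m (\<lambda>i. x (i + 1)) @\<^sub>v vec m (\<lambda>i. f_coord q m I J \<alpha> x (i + 1))" for x
  have U: "U_set q m I J \<alpha> = range emb"
    by (auto simp: U_set_def emb_def)
  have carrier: "emb x \<in> carrier_vec (2 * m)" for x
    by (auto simp: emb_def mult_2)
  have add: "emb x + emb y = emb (\<lambda>i. x i + y i)" for x y
    by (rule eq_vecI)
       (auto simp: emb_def f_coord_def frobenius_add[OF assms] algebra_simps)
  have smult: "c \<cdot>\<^sub>v emb x = emb (\<lambda>i. c * x i)" if "c ^ q = c" for c x
    using that
    by (intro eq_vecI)
       (auto simp: emb_def f_coord_def power_mult_distrib power_power_fixed algebra_simps)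
  have zero: "0\<^sub>v (2 * m) = emb (\<lambda>i. 0)"
    using q by (intro eq_vecI) (auto simp: emb_def f_coord_def zero_power)
  show "submodule (Fq q) (U_set q m I J \<alpha>) (module_vec TYPE('a) (2 * m))"
  proof (rule submodule.intro)
    show "Module.module (Fq q) (module_vec TYPE('a) (2 * m))"
      using vs by (simp add: vectorspace_def)
  qed (use carrier add smult zero in \<open>auto simp: U module_vec_simps Fq_simps\<close>)
qed

lemma span_singleton_vec:
  assumes "(v :: 'a::field vec) \<in> carrier_vec k"
  shows "LinearCombinations.module.span class_ring (module_vec TYPE('a) k) {v} = {a \<cdot>\<^sub>v v | a. True}"
proof -
  interpret V: vec_space "TYPE('a)" k .
  show ?thesis
    using assms by (force simp: V.finite_span V.lincomb_def)
qed

text \<open>The generator \<open>u\<close> may be zero, so a trivial intersection is covered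
  too.\<close>

lemma dim_le_1_if_proportional:
  assumes "vectorspace K V" and "submodule K W V" and "u \<in> W"
    and "\<And>w. w \<in> W \<Longrightarrow> \<exists>c \<in> carrier K. w = c \<odot>\<^bsub>V\<^esub> u"
  shows "vectorspace.dim K (V\<lparr>carrier := W\<rparr>) \<le> 1"
proof -
  interpret V: vectorspace K V
    by fact
  interpret W: vectorspace K "V\<lparr>carrier := W\<rparr>"
    using assms(1,2) by (intro V.subspace_is_vs) (simp add: VectorSpace.subspace_def)
  have "W.span {u} = W"
  proof
    show "W.span {u} \<subseteq> W"
      using W.span_is_subset2[of "{u}"] assms(3) by simp
    show "W \<subseteq> W.span {u}"
    proof
      fix w
      assume "w \<in> W"
      then obtain c where "c \<in> carrier K" "w = c \<odot>\<^bsub>V\<^esub> u"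
        using assms(4) by blast
      moreover have "u \<in> W.span {u}"
        using W.in_own_span[of "{u}"] assms(3) by simp
      moreover have "submodule K (W.span {u}) (V\<lparr>carrier := W\<rparr>)"
        using W.span_is_submodule[of "{u}"] assms(3) by simp
      ultimately show "w \<in> W.span {u}"
        using submodule.smult_closed by fastforce
    qed
  qed
  then show ?thesis
    using W.dim_le1I[of u] assms(3) by simp
qed

section \<open>Intersections of U with lines\<close>

theorem theorem2p4:
  fixes q n m I J :: nat
    and \<alpha> :: "nat \<Rightarrow> 'a::{field,finite}"
  assumes "primepow q"
    and "CARD('a) = q ^ n"
    and "n > 0"
    and "m \<ge> 3"
    and "I < J" and "J < n"
    and "\<forall>i \<in> {1..m}. \<alpha> i \<noteq> 0"
    and "gcd I J = 1"
    and "\<not> is_nth_power (C_const q (J - I) m) (K_const q m I J \<alpha>)"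
  shows "scattered q (2 * m) (U_set q m I J \<alpha>)"
  unfolding scattered_def
proof (intro conjI ballI)
  let ?V = "module_vec TYPE('a) (2 * m)"
  let ?U = "U_set q m I J \<alpha>"
  show sub: "VectorSpace.subspace (Fq q) ?U ?V"
    by (rule subspace_U_set[OF assms(1,2)])
  then interpret U: submodule "Fq q" ?U ?V
    by (rule subspace.submod)
  have q: "q > 1"
    using primepow_gt_Suc_0[OF assms(1)] by simp
  have Fq_ratio: "c ^ q = c" if "u \<in> ?U" "c \<cdot>\<^sub>v u \<in> ?U" "u \<noteq> 0\<^sub>v (2 * m)" for c u
  proof -
    obtain x where x: "u = vec m (\<lambda>i. x (i + 1)) @\<^sub>v vec m (\<lambda>i. f_coord q m I J \<alpha> x (i + 1))"
      using \<open>u \<in> ?U\<close> by (auto simp: U_set_def)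
    obtain z where z: "c \<cdot>\<^sub>v u = vec m (\<lambda>i. z (i + 1)) @\<^sub>v vec m (\<lambda>i. f_coord q m I J \<alpha> z (i + 1))"
      using \<open>c \<cdot>\<^sub>v u \<in> ?U\<close> by (auto simp: U_set_def)
    have zx: "z i = c * x i" if "i \<in> {1..m}" for i
      using arg_cong[OF z, of "\<lambda>v. v $ (i - 1)"] that by (cases i) (auto simp: x)
    have fz: "f_coord q m I J \<alpha> z i = c * f_coord q m I J \<alpha> x i" if "i \<in> {1..m}" for i
      using arg_cong[OF z, of "\<lambda>v. v $ (m + (i - 1))"] that by (cases i) (auto simp: x)
    \<comment> \<open>The families \<open>z\<close> and \<open>c * x\<close> need only agree on
      \<open>{1..m}\<close>, and \<open>f_coord\<close> reads no other index.\<close>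
    have "f_coord q m I J \<alpha> (\<lambda>j. c * x j) i = f_coord q m I J \<alpha> z i" if "i \<in> {1..m}" for i
      using that assms(4) by (simp add: f_coord_def zx)
    then have "f_coord q m I J \<alpha> (\<lambda>j. c * x j) i = c * f_coord q m I J \<alpha> x i" if "i \<in> {1..m}" for i
      using that fz by simp
    moreover have "\<exists>i \<in> {1..m}. x i \<noteq> 0"
    proof (rule ccontr)
      assume "\<not> (\<exists>i \<in> {1..m}. x i \<noteq> 0)"
      then have "u = 0\<^sub>v (2 * m)"
        using q assms(4) by (intro eq_vecI) (auto simp: x f_coord_def zero_power)
      with \<open>u \<noteq> 0\<^sub>v (2 * m)\<close> show False ..
    qed
    ultimately show ?thesis
      using f_coord_proportional_imp_Fq[OF q assms(5,4,7,8,9)] by blast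
  qed
  fix v :: "'a vec"
  assume v: "v \<in> carrier_vec (2 * m)"
  define L where "L = {a \<cdot>\<^sub>v v | a. True}"
  have "submodule (Fq q) (?U \<inter> L) ?V"
  proof (rule submodule.intro[OF U.module])
    show "a \<oplus>\<^bsub>?V\<^esub> b \<in> ?U \<inter> L" if "a \<in> ?U \<inter> L" "b \<in> ?U \<inter> L" for a b
      using that U.m_closed[of a b]
      by (auto simp: L_def module_vec_simps add_smult_distrib_vec[symmetric])
    show "c \<odot>\<^bsub>?V\<^esub> a \<in> ?U \<inter> L" if "c \<in> carrier (Fq q)" "a \<in> ?U \<inter> L" for c a
      using that U.smult_closed[of c a]
      by (auto simp: L_def module_vec_simps smult_smult_assoc)
    have "0\<^sub>v (2 * m) = 0 \<cdot>\<^sub>v v"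
      using v by auto
    then show "\<zero>\<^bsub>?V\<^esub> \<in> ?U \<inter> L"
      using U.zero_closed by (auto simp: L_def module_vec_simps)
  qed (use U.subset in auto)
  \<comment> \<open>Any nonzero \<open>u\<close> in the intersection works: other members are
    multiples of it by some ratio, which \<open>Fq_ratio\<close> places in the subfield. If there is
    none, the zero vector works.\<close>
  moreover have "\<exists>u \<in> ?U \<inter> L. \<forall>w \<in> ?U \<inter> L. \<exists>c \<in> carrier (Fq q). w = c \<odot>\<^bsub>?V\<^esub> u"
  proof (cases "\<exists>u \<in> ?U \<inter> L. u \<noteq> 0\<^sub>v (2 * m)")
    case True
    then obtain a where a: "a \<cdot>\<^sub>v v \<in> ?U" "a \<cdot>\<^sub>v v \<noteq> 0\<^sub>v (2 * m)"
      by (auto simp: L_def)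
    have "a \<noteq> 0"
      using a(2) v by auto
    have "\<exists>c \<in> carrier (Fq q). w = c \<cdot>\<^sub>v (a \<cdot>\<^sub>v v)" if "w \<in> ?U \<inter> L" for w
    proof -
      obtain b where b: "w = b \<cdot>\<^sub>v v"
        using \<open>w \<in> ?U \<inter> L\<close> by (auto simp: L_def)
      then have w: "w = (b / a) \<cdot>\<^sub>v (a \<cdot>\<^sub>v v)"
        using \<open>a \<noteq> 0\<close> by (simp add: smult_smult_assoc)
      then have "(b / a) ^ q = b / a"
        using Fq_ratio[OF a(1) _ a(2)] \<open>w \<in> ?U \<inter> L\<close> by simp
      with w show ?thesis
        by (auto simp: Fq_simps)
    qed
    then show ?thesis
      using a(1) by (intro bexI[of _ "a \<cdot>\<^sub>v v"]) (auto simp: L_def module_vec_simps)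
  next
    case False
    have "\<exists>c \<in> carrier (Fq q). w = c \<odot>\<^bsub>?V\<^esub> 0\<^sub>v (2 * m)" if "w \<in> ?U \<inter> L" for w
    proof -
      have "w = 0\<^sub>v (2 * m)"
        using False that by blast
      then show ?thesis
        by (intro bexI[of _ 1]) (simp_all add: module_vec_simps Fq_simps)
    qed
    moreover have "0\<^sub>v (2 * m) \<in> ?U \<inter> L"
      using submodule.zero_closed[OF \<open>submodule (Fq q) (?U \<inter> L) ?V\<close>]
      by (simp only: module_vec_simps)
    ultimately show ?thesis
      by blast
  qed
  ultimately have "vectorspace.dim (Fq q) (?V\<lparr>carrier := ?U \<inter> L\<rparr>) \<le> 1"
    using dim_le_1_if_proportional[OF subspace.vs[OF sub]] by blast
  then show "vectorspace.dim (Fq q)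
      (?V\<lparr>carrier := ?U \<inter> LinearCombinations.module.span class_ring ?V {v}\<rparr>) \<le> 1"
    by (simp only: span_singleton_vec[OF v] L_def)
qed

end
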